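(* Let $N$ be a finite set and let $\alpha \in \mathcal{A}_N$. Then $$\mathcal{A}_N = \bigcup_{\chi \subseteq \alpha} [\chi, \operatorname{nd}(\alpha \setminus \chi)],$$ where the union is over all subsets $\chi$ of $\alpha$, and all intervals in the union are (pairwise) disjoint.
   Context: For a finite set $N$, $\mathcal{A}_N$ denotes the set of antichains in $N$: sets $\alpha \subseteq 2^N$ of subsets of $N$ such that no two distinct members of $\alpha$ are in a subset/superset relationship (the empty set of subsets, denoted $\bot=\{\}$, is allowed, and so is $\{\emptyset\}$). Order: $\alpha \le \beta$ iff for every $A \in \alpha$ there is $B \in \beta$ with $A \subseteq B$. Intervals: $[\alpha,\beta]=\{\chi \in \mathcal{A}_N : \alpha \le \chi \le \beta\}$. For $\chi \in \mathcal{A}_N$, $\operatorname{nd}(\chi)$ denotes the largest antichain (with respect to $\le$) that does not dominate any of the sets in $\chi$: $\operatorname{nd}(\chi)\in\mathcal{A}_N$, $\{X\} \not\le \operatorname{nd}(\chi)$ for all $X \in \chi$, and every $\rho \in \mathcal{A}_N$ with $\{X\}\not\le\rho$ for all $X \in \chi$ satisfies $\rho \le \operatorname{nd}(\chi)$. (This maximum always exists.) *)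

theory Defs
  imports "HOL-Library.Disjoint_Sets"
begin

definition antichains :: "'a set \<Rightarrow> 'a set set set" where
  "antichains N = {\<alpha>. \<alpha> \<subseteq> Pow N \<and> pairwise (\<lambda>A B. \<not> A \<subseteq> B) \<alpha>}"

definition ac_le :: "'a set set \<Rightarrow> 'a set set \<Rightarrow> bool" (infix "\<preceq>" 50) where
  "\<alpha> \<preceq> \<beta> \<longleftrightarrow> (\<forall>A\<in>\<alpha>. \<exists>B\<in>\<beta>. A \<subseteq> B)"

definition ac_interval :: "'a set \<Rightarrow> 'a set set \<Rightarrow> 'a set set \<Rightarrow> 'a set set set" where
  "ac_interval N \<alpha> \<beta> = {\<chi> \<in> antichains N. \<alpha> \<preceq> \<chi> \<and> \<chi> \<preceq> \<beta>}"

definition nondominating :: "'a set \<Rightarrow> 'a set set \<Rightarrow> 'a set set set" where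
  "nondominating N \<chi> = {\<rho> \<in> antichains N. \<forall>X\<in>\<chi>. \<not> {X} \<preceq> \<rho>}"

definition nd :: "'a set \<Rightarrow> 'a set set \<Rightarrow> 'a set set" where
  "nd N \<chi> = (THE \<mu>. \<mu> \<in> nondominating N \<chi> \<and> (\<forall>\<rho>\<in>nondominating N \<chi>. \<rho> \<preceq> \<mu>))"

lemma ac_le_antisym:
  assumes "\<alpha> \<in> antichains N" "\<beta> \<in> antichains N" "\<alpha> \<preceq> \<beta>" "\<beta> \<preceq> \<alpha>"
  shows "\<alpha> = \<beta>"
proof -
  have "\<alpha> \<subseteq> \<beta>" if \<alpha>: "\<alpha> \<in> antichains N" and le: "\<alpha> \<preceq> \<beta>" and ge: "\<beta> \<preceq> \<alpha>" for \<alpha> \<beta> :: "'a set set"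
  proof
    fix A assume A: "A \<in> \<alpha>"
    then obtain B where B: "B \<in> \<beta>" "A \<subseteq> B" using le by (auto simp: ac_le_def)
    then obtain A' where A': "A' \<in> \<alpha>" "B \<subseteq> A'" using ge by (auto simp: ac_le_def)
    have "A \<subseteq> A'" using A' B by blast
    then have "A = A'" using A A' \<alpha> by (auto simp only: antichains_def pairwise_def)
    then show "A \<in> \<beta>" using A' B by (simp add: subset_antisym)
  qed
  then show ?thesis using assms by blast
qed

text \<open>The maximum in the definition of \<^const>\<open>nd\<close> exists and is unique.\<close>

lemma nd_ex1:
  assumes "finite N"
  shows "\<exists>!\<mu>. \<mu> \<in> nondominating N \<chi> \<and> (\<forall>\<rho>\<in>nondominating N \<chi>. \<rho> \<preceq> \<mu>)"
proof (rule ex_ex1I)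
  define S where "S = {A \<in> Pow N. \<forall>X\<in>\<chi>. \<not> X \<subseteq> A}"
  define M where "M = {A \<in> S. \<forall>B\<in>S. A \<subseteq> B \<longrightarrow> A = B}"
  have fin: "finite S" using assms by (simp add: S_def)
  have M: "M \<in> nondominating N \<chi>"
    by (auto simp: M_def S_def nondominating_def antichains_def pairwise_def ac_le_def)
  have "\<rho> \<preceq> M" if r: "\<rho> \<in> nondominating N \<chi>" for \<rho>
    unfolding ac_le_def
  proof
    fix A assume "A \<in> \<rho>"
    then have "A \<in> S" using r by (auto simp: S_def nondominating_def antichains_def ac_le_def)
    then obtain B where "B \<in> S" "A \<subseteq> B" "\<forall>C\<in>S. B \<subseteq> C \<longrightarrow> B = C"
      using finite_has_maximal2[OF fin] by metis
    then show "\<exists>B\<in>M. A \<subseteq> B" by (auto simp: M_def)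
  qed
  with M show "\<exists>\<mu>. \<mu> \<in> nondominating N \<chi> \<and> (\<forall>\<rho>\<in>nondominating N \<chi>. \<rho> \<preceq> \<mu>)" by blast
next
  fix \<mu> \<nu>
  assume "\<mu> \<in> nondominating N \<chi> \<and> (\<forall>\<rho>\<in>nondominating N \<chi>. \<rho> \<preceq> \<mu>)"
    and "\<nu> \<in> nondominating N \<chi> \<and> (\<forall>\<rho>\<in>nondominating N \<chi>. \<rho> \<preceq> \<nu>)"
  then show "\<mu> = \<nu>" by (intro ac_le_antisym[of _ N]) (auto simp: nondominating_def)
qed

end

theory Submission
  imports Defs
begin

text \<open>An antichain \<open>\<rho>\<close> lies below \<open>nd(\<alpha> \<setminus> \<chi>)\<close> iff it dominates no member of \<open>\<alpha> \<setminus> \<chi>\<close>, and above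
  \<open>\<chi>\<close> iff it dominates every member of \<open>\<chi>\<close>. Hence \<open>\<rho>\<close> lies in exactly one of the intervals, namely
  the one with \<open>\<chi>\<close> the set of all members of \<open>\<alpha>\<close> that \<open>\<rho>\<close> dominates.\<close>

lemma ac_le_trans:
  assumes "\<alpha> \<preceq> \<beta>" "\<beta> \<preceq> \<gamma>"
  shows "\<alpha> \<preceq> \<gamma>"
  using assms unfolding ac_le_def by (meson subset_trans)

lemma ac_le_iff_singletons: "\<chi> \<preceq> \<rho> \<longleftrightarrow> (\<forall>A\<in>\<chi>. {A} \<preceq> \<rho>)"
  by (simp add: ac_le_def)

text \<open>Domination passes upward along \<open>\<preceq>\<close>, so anything below
  \<open>nd N \<chi>\<close> inherits its failure to dominate members of \<open>\<chi>\<close>.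
  Conversely, \<open>nd N \<chi>\<close> is the maximum of
  \<open>nondominating N \<chi>\<close>.\<close>

lemma ac_le_nd_iff:
  assumes "finite N" "\<rho> \<in> antichains N"
  shows "\<rho> \<preceq> nd N \<chi> \<longleftrightarrow> (\<forall>X\<in>\<chi>. \<not> {X} \<preceq> \<rho>)"
proof -
  \<comment> \<open>Since \<open>nd\<close> is a definite description, its properties rest on unique
    existence; here finiteness of \<open>N\<close> enters.\<close>
  have nd: "nd N \<chi> \<in> nondominating N \<chi> \<and> (\<forall>\<rho>\<in>nondominating N \<chi>. \<rho> \<preceq> nd N \<chi>)"
    unfolding nd_def by (rule theI'[OF nd_ex1[OF assms(1)]])
  show ?thesis
  proof
    assume le: "\<rho> \<preceq> nd N \<chi>"
    have "\<not> {X} \<preceq> nd N \<chi>" if "X \<in> \<chi>" for X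
      using nd that by (simp add: nondominating_def)
    then show "\<forall>X\<in>\<chi>. \<not> {X} \<preceq> \<rho>"
      using ac_le_trans[OF _ le] by blast
  next
    assume "\<forall>X\<in>\<chi>. \<not> {X} \<preceq> \<rho>"
    then show "\<rho> \<preceq> nd N \<chi>"
      using nd assms(2) by (simp add: nondominating_def)
  qed
qed

text \<open>Covering and disjointness both reduce to this: \<open>\<rho>\<close> determines the
  index of its interval.\<close>

lemma mem_ac_interval_nd_iff:
  assumes "finite N" "\<chi> \<subseteq> \<alpha>"
  shows "\<rho> \<in> ac_interval N \<chi> (nd N (\<alpha> - \<chi>)) \<longleftrightarrow> \<rho> \<in> antichains N \<and> \<chi> = {A \<in> \<alpha>. {A} \<preceq> \<rho>}"
proof (cases "\<rho> \<in> antichains N")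
  case True
  have "\<rho> \<in> ac_interval N \<chi> (nd N (\<alpha> - \<chi>)) \<longleftrightarrow>
      (\<forall>A\<in>\<chi>. {A} \<preceq> \<rho>) \<and> (\<forall>A\<in>\<alpha> - \<chi>. \<not> {A} \<preceq> \<rho>)"
    using True ac_le_iff_singletons[of \<chi> \<rho>] ac_le_nd_iff[OF assms(1) True]
    by (simp add: ac_interval_def)
  \<comment> \<open>As \<open>\<chi> \<subseteq> \<alpha>\<close>, the two conjuncts are the two
    inclusions of this equality.\<close>
  also have "\<dots> \<longleftrightarrow> \<chi> = {A \<in> \<alpha>. {A} \<preceq> \<rho>}"
    using assms(2) by blast
  finally show ?thesis
    using True by simp
qed (simp add: ac_interval_def)

theorem theorem5p1:
  fixes N :: "'a set" and \<alpha> :: "'a set set"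
  assumes "finite N" and "\<alpha> \<in> antichains N"
  shows "antichains N = (\<Union>\<chi>\<in>Pow \<alpha>. ac_interval N \<chi> (nd N (\<alpha> - \<chi>)))
    \<and> disjoint_family_on (\<lambda>\<chi>. ac_interval N \<chi> (nd N (\<alpha> - \<chi>))) (Pow \<alpha>)"
proof
  note mem = mem_ac_interval_nd_iff[OF assms(1)]
  show "antichains N = (\<Union>\<chi>\<in>Pow \<alpha>. ac_interval N \<chi> (nd N (\<alpha> - \<chi>)))"
  proof
    show "antichains N \<subseteq> (\<Union>\<chi>\<in>Pow \<alpha>. ac_interval N \<chi> (nd N (\<alpha> - \<chi>)))"
    proof
      fix \<rho> assume \<rho>: "\<rho> \<in> antichains N"
      define \<chi> where "\<chi> = {A \<in> \<alpha>. {A} \<preceq> \<rho>}"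
      then have sub: "\<chi> \<subseteq> \<alpha>"
        by simp
      then have "\<rho> \<in> ac_interval N \<chi> (nd N (\<alpha> - \<chi>))"
        using mem \<rho> \<chi>_def by blast
      with sub show "\<rho> \<in> (\<Union>\<chi>\<in>Pow \<alpha>. ac_interval N \<chi> (nd N (\<alpha> - \<chi>)))"
        by (intro UN_I PowI)
    qed
  \<comment> \<open>The reverse inclusion: intervals consist of antichains by definition.\<close>
  qed (auto simp: ac_interval_def)
  show "disjoint_family_on (\<lambda>\<chi>. ac_interval N \<chi> (nd N (\<alpha> - \<chi>))) (Pow \<alpha>)"
    unfolding disjoint_family_on_def
  proof (intro ballI impI equals0I)
    fix \<chi> \<psi> \<rho>
    assume "\<chi> \<in> Pow \<alpha>" "\<psi> \<in> Pow \<alpha>" "\<chi> \<noteq> \<psi>"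
      and "\<rho> \<in> ac_interval N \<chi> (nd N (\<alpha> - \<chi>)) \<inter> ac_interval N \<psi> (nd N (\<alpha> - \<psi>))"
    then have "\<chi> = {A \<in> \<alpha>. {A} \<preceq> \<rho>}" "\<psi> = {A \<in> \<alpha>. {A} \<preceq> \<rho>}"
      using mem[of \<chi> \<alpha> \<rho>] mem[of \<psi> \<alpha> \<rho>] by blast+
    with \<open>\<chi> \<noteq> \<psi>\<close> show False
      by metis
  qed
qed

end
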